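(* Let $E$ be a nonzero reflexive real Banach space, let $f,g\colon E\times E^*\to\,]{-}\infty,\infty]$ be proper convex lower semicontinuous BC--functions such that $\bigcup_{\lambda>0}\lambda[\pi_1\mathrm{dom}\,f-\pi_1\mathrm{dom}\,g]$ is a closed linear subspace of $E$. Then $\{(x,s^*+t^* )\colon (x,s^* )\in{\cal P}_q(f),\ (x,t^* )\in{\cal P}_q(g)\}$ is a maximally monotone subset of $E\times E^*$.
   Context: $\pi_1(x,x^* ):=x$; $\mathrm{dom}\,f:=\{(x,x^* )\colon f(x,x^* )\in\mathbb{R}\}$. On $E\times E^*$ set $\lfloor(x,x^* ),(y,y^* )\rfloor:=\langle x,y^*\rangle+\langle y,x^*\rangle$ and $q(x,x^* ):=\langle x,x^*\rangle$. For $k$ on $E\times E^*$, $k^@(y,y^* ):=\sup_{(x,x^* )}[\lfloor(x,x^* ),(y,y^* )\rfloor-k(x,x^* )]$; a BC--function is a proper convex $k$ with $k^@\ge k\ge q$; ${\cal P}_q(k):=\{(x,x^* )\colon k(x,x^* )=\langle x,x^*\rangle\}$. A set $A\subset E\times E^*$ is monotone if nonempty with $\langle x-y,x^*-y^*\rangle\ge0$ on $A$, maximally monotone if not properly contained in another monotone set. *)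

theory Defs
  imports "HOL-Analysis.Analysis"
begin

definition reflexive_space :: "'a::banach itself \<Rightarrow> bool" where
  "reflexive_space _ \<longleftrightarrow>
     (\<forall>\<Phi> :: ('a \<Rightarrow>\<^sub>L real) \<Rightarrow>\<^sub>L real. \<exists>x::'a. \<forall>\<phi>. blinfun_apply \<Phi> \<phi> = blinfun_apply \<phi> x)"

definition pi1 :: "'a \<times> ('a \<Rightarrow>\<^sub>L real) \<Rightarrow> 'a" where
  "pi1 p = fst p"

definition edom :: "('a \<times> ('a \<Rightarrow>\<^sub>L real) \<Rightarrow> ereal) \<Rightarrow> ('a \<times> ('a \<Rightarrow>\<^sub>L real)) set" where
  "edom f = {p. f p \<noteq> \<infinity> \<and> f p \<noteq> -\<infinity>}"

definition bracket :: "'a::real_normed_vector \<times> ('a \<Rightarrow>\<^sub>L real) \<Rightarrow> 'a \<times> ('a \<Rightarrow>\<^sub>L real) \<Rightarrow> real" where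
  "bracket p r = blinfun_apply (snd r) (fst p) + blinfun_apply (snd p) (fst r)"

definition qf :: "'a::real_normed_vector \<times> ('a \<Rightarrow>\<^sub>L real) \<Rightarrow> real" where
  "qf p = blinfun_apply (snd p) (fst p)"

definition conj_at :: "('a::real_normed_vector \<times> ('a \<Rightarrow>\<^sub>L real) \<Rightarrow> ereal)
    \<Rightarrow> 'a \<times> ('a \<Rightarrow>\<^sub>L real) \<Rightarrow> ereal" where
  "conj_at k r = (SUP p. ereal (bracket p r) - k p)"

definition proper_fun :: "('b \<Rightarrow> ereal) \<Rightarrow> bool" where
  "proper_fun f \<longleftrightarrow> (\<forall>z. f z \<noteq> -\<infinity>) \<and> (\<exists>z. f z \<noteq> \<infinity>)"

definition convex_fun :: "('b::real_vector \<Rightarrow> ereal) \<Rightarrow> bool" where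
  "convex_fun f \<longleftrightarrow> (\<forall>x y t. 0 < t \<and> t < 1 \<longrightarrow>
      f ((1 - t) *\<^sub>R x + t *\<^sub>R y) \<le> ereal (1 - t) * f x + ereal t * f y)"

definition lsc_fun :: "('b::topological_space \<Rightarrow> ereal) \<Rightarrow> bool" where
  "lsc_fun f \<longleftrightarrow> (\<forall>c::real. closed {z. f z \<le> ereal c})"

definition BC_function :: "('a::real_normed_vector \<times> ('a \<Rightarrow>\<^sub>L real) \<Rightarrow> ereal) \<Rightarrow> bool" where
  "BC_function k \<longleftrightarrow> proper_fun k \<and> convex_fun k \<and>
     (\<forall>p. conj_at k p \<ge> k p \<and> k p \<ge> ereal (qf p))"

definition Pq :: "('a::real_normed_vector \<times> ('a \<Rightarrow>\<^sub>L real) \<Rightarrow> ereal) \<Rightarrow> ('a \<times> ('a \<Rightarrow>\<^sub>L real)) set" where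
  "Pq k = {p. k p = ereal (qf p)}"

definition monotone_set :: "('a::real_normed_vector \<times> ('a \<Rightarrow>\<^sub>L real)) set \<Rightarrow> bool" where
  "monotone_set A \<longleftrightarrow> A \<noteq> {} \<and>
     (\<forall>(x, xs)\<in>A. \<forall>(y, ys)\<in>A. blinfun_apply (xs - ys) (x - y) \<ge> 0)"

definition maximally_monotone :: "('a::real_normed_vector \<times> ('a \<Rightarrow>\<^sub>L real)) set \<Rightarrow> bool" where
  "maximally_monotone A \<longleftrightarrow> monotone_set A \<and> (\<forall>B. monotone_set B \<and> A \<subseteq> B \<longrightarrow> B = A)"

end

theory Submission
  imports Defs
begin

text \<open>For \<open>w\<close> in \<open>E \<times> E\<^sup>*\<close> we find a point \<open>m\<close> of the pointwise sum \<open>M\<close> of \<open>Pq f\<close> and \<open>Pq g\<close>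
  with \<open>q(m - w) + (\<parallel>m\<^sub>1 - w\<^sub>1\<parallel>\<^sup>2 + \<parallel>m\<^sub>2 - w\<^sub>2\<parallel>\<^sup>2) / 2 \<le> 0\<close>; if \<open>w\<close> is monotonically related to \<open>M\<close>,
  then \<open>q(m - w) \<ge> 0\<close>, whence \<open>w = m\<close>. The point \<open>m\<close> is read off from a Lagrange multiplier for
  minimising \<open>f(x, s) + g(x', t) + G(P)\<close> subject to \<open>x = x'\<close> and \<open>P = (x, s + t)\<close>, where
  \<open>G(P) = (\<parallel>P\<^sub>1 - w\<^sub>1\<parallel>\<^sup>2 + \<parallel>P\<^sub>2 - w\<^sub>2\<parallel>\<^sup>2) / 2 + q(w) - \<lfloor>P, w\<rfloor>\<close>: since \<open>f, g \<ge> q\<close> the minimum is at least \<open>0\<close>,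
  and the multiplier inequality bounds \<open>f\<^sup>@ + g\<^sup>@\<close> from above at points \<open>(m\<^sub>1, s)\<close> and \<open>(m\<^sub>1, t)\<close> with
  \<open>s + t = m\<^sub>2\<close>, which together with \<open>f\<^sup>@ \<ge> f \<ge> q\<close> and \<open>g\<^sup>@ \<ge> g \<ge> q\<close> forces equality. The multiplier
  exists by the Hahn--Banach theorem, the constraint qualification entering through a Baire category
  argument. Reflexivity turns its \<open>E\<^sup>*\<^sup>*\<close>-component into a point of \<open>E\<close>.\<close>

section \<open>Sublinear functionals\<close>

definition sublinear :: "('a::real_vector \<Rightarrow> real) \<Rightarrow> bool" where
  "sublinear S \<longleftrightarrow> (\<forall>u v. S (u + v) \<le> S u + S v) \<and> (\<forall>c\<ge>0. \<forall>u. S (c *\<^sub>R u) = c * S u)"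

lemma sublinear_add: "sublinear S \<Longrightarrow> S (u + v) \<le> S u + S v"
  and sublinear_scale: "sublinear S \<Longrightarrow> c \<ge> 0 \<Longrightarrow> S (c *\<^sub>R u) = c * S u"
  by (simp_all add: sublinear_def)

lemma sublinear_zero: "sublinear S \<Longrightarrow> S 0 = 0"
  using sublinear_scale[of S 0 0] by simp

lemma sublinear_minus: "sublinear S \<Longrightarrow> - S (- u) \<le> S u"
  using sublinear_add[of S u "- u"] sublinear_zero[of S] by simp

text \<open>One-sided homogeneity is enough: applied to \<open>inverse c\<close> and
  \<open>c *\<^sub>R u\<close> it gives the reverse inequality.\<close>

lemma sublinearI:
  assumes add: "\<And>u v. S (u + v) \<le> S u + S v"
    and scale: "\<And>c u. c > 0 \<Longrightarrow> S (c *\<^sub>R u) \<le> c * S u"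
    and zero: "S 0 = 0"
  shows "sublinear S"
  unfolding sublinear_def
proof (intro conjI allI impI add)
  fix c :: real and u
  assume "0 \<le> c"
  show "S (c *\<^sub>R u) = c * S u"
  proof (cases "c = 0")
    case True
    then show ?thesis by (simp add: zero)
  next
    case False
    with \<open>0 \<le> c\<close> have c: "c > 0" by simp
    have "S u \<le> inverse c * S (c *\<^sub>R u)"
      using scale[of "inverse c" "c *\<^sub>R u"] c by simp
    then have "c * S u \<le> S (c *\<^sub>R u)"
      using c by (simp add: field_simps)
    with scale[OF c, of u] show ?thesis by simp
  qed
qed

lemma convex_on_singleton: "convex_on {v} F"
  unfolding convex_on_def
proof (intro conjI ballI allI impI convex_singleton)
  fix x y and a b :: real
  assume "x \<in> {v}" "y \<in> {v}" "a + b = 1"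
  moreover from \<open>a + b = 1\<close> have "a *\<^sub>R v + b *\<^sub>R v = v" "a * F v + b * F v = F v"
    by (simp_all flip: scaleR_left_distrib distrib_right)
  ultimately show "F (a *\<^sub>R x + b *\<^sub>R y) \<le> a * F x + b * F y"
    by auto
qed

text \<open>Taking \<open>D = {v}\<close> and \<open>F v = - S v\<close> also shows that minimal sublinear functionals are odd.\<close>

lemma sublinear_lower_hull:
  fixes S :: "'a::real_vector \<Rightarrow> real" and j :: "'z::real_vector \<Rightarrow> 'a"
  assumes S: "sublinear S" and j: "linear j" and F: "convex_on D F" and "D \<noteq> {}"
    and nonneg: "\<And>z. z \<in> D \<Longrightarrow> 0 \<le> F z + S (j z)"
  obtains T where "sublinear T" "\<And>u. T u \<le> S u" "\<And>z. z \<in> D \<Longrightarrow> T (- j z) \<le> F z"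
proof
  \<comment> \<open>Every sublinear \<open>T' \<le> S\<close> with
    \<open>T' (- j z) \<le> F z\<close> on \<open>D\<close> satisfies
    \<open>T' u \<le> h u p\<close> for all \<open>p \<in> I\<close>, so the infimum
    \<open>T\<close> is the largest possible candidate.\<close>
  define h where "h u p = S (u + fst p *\<^sub>R j (snd p)) + fst p * F (snd p)" for u and p :: "real \<times> 'z"
  define I where "I = {0::real..} \<times> D"
  define T where "T u = (INF p\<in>I. h u p)" for u
  have I: "I \<noteq> {}" using \<open>D \<noteq> {}\<close> by (auto simp: I_def)
  \<comment> \<open>Here \<open>nonneg\<close> makes the infimum finite.\<close>
  have low: "- S (- u) \<le> h u p" if "p \<in> I" for u p
  proof -
    obtain l z where p: "p = (l, z)" "l \<ge> 0" "z \<in> D"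
      using \<open>p \<in> I\<close> by (auto simp: I_def)
    have "S (l *\<^sub>R j z) \<le> S (u + l *\<^sub>R j z) + S (- u)"
      using sublinear_add[OF S, of "u + l *\<^sub>R j z" "- u"] by simp
    moreover have "0 \<le> l * (F z + S (j z))"
      using p nonneg by simp
    ultimately show ?thesis
      using sublinear_scale[OF S, of l "j z"] p by (simp add: h_def algebra_simps)
  qed
  have bdd: "bdd_below (h u ` I)" for u
    using low by (intro bdd_belowI2[where m = "- S (- u)"])
  have le: "T u \<le> h u p" if "p \<in> I" for u p
    unfolding T_def using bdd that by (rule cINF_lower)
  have ge: "c \<le> T u" if "\<And>p. p \<in> I \<Longrightarrow> c \<le> h u p" for c u
    unfolding T_def using I that by (rule cINF_greatest)
  obtain z0 where z0: "z0 \<in> D" using \<open>D \<noteq> {}\<close> by blast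
  show TS: "T u \<le> S u" for u
    using le[of "(0, z0)" u] z0 by (simp add: I_def h_def)
  show "T (- j z) \<le> F z" if "z \<in> D" for z
    using le[of "(1, z)" "- j z"] that sublinear_zero[OF S] by (simp add: I_def h_def)
  show "sublinear T"
  proof (rule sublinearI)
    show "T 0 = 0"
      using TS[of 0] ge[of "- S (- 0)" 0] low[of _ 0] sublinear_zero[OF S] by force
  next
    fix c :: real and u
    assume c: "c > 0"
    have "inverse c * T (c *\<^sub>R u) \<le> T u"
    proof (rule ge)
      fix p assume "p \<in> I"
      then have "T (c *\<^sub>R u) \<le> h (c *\<^sub>R u) (c * fst p, snd p)"
        using c by (intro le) (auto simp: I_def)
      also have "\<dots> = S (c *\<^sub>R (u + fst p *\<^sub>R j (snd p))) + c * fst p * F (snd p)"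
        by (simp add: h_def algebra_simps)
      also have "\<dots> = c * h u p"
        using sublinear_scale[OF S, of c "u + fst p *\<^sub>R j (snd p)"] c
        by (simp add: h_def distrib_left)
      finally show "inverse c * T (c *\<^sub>R u) \<le> h u p"
        using c by (simp add: field_simps)
    qed
    then show "T (c *\<^sub>R u) \<le> c * T u"
      using c by (simp add: field_simps)
  next
    fix u v
    have *: "T (u + v) \<le> h u p + h v q" if "p \<in> I" "q \<in> I" for p q
    proof -
      obtain l z where p: "p = (l, z)" "l \<ge> 0" "z \<in> D" using \<open>p \<in> I\<close> by (auto simp: I_def)
      obtain m y where q: "q = (m, y)" "m \<ge> 0" "y \<in> D" using \<open>q \<in> I\<close> by (auto simp: I_def)
      show ?thesis
      proof (cases "l + m = 0")
        case True
        then have "l = 0" "m = 0" using p q by auto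
        then show ?thesis
          using TS[of "u + v"] sublinear_add[OF S, of u v] p q by (simp add: h_def)
      next
        case False
        then have lm: "l + m > 0" using p q by simp
        \<comment> \<open>The index \<open>(l + m, w)\<close> merges \<open>(l, z)\<close> and
          \<open>(m, y)\<close>: the shifts by \<open>j\<close> add up exactly, and convexity bounds
          the cost \<open>(l + m) * F w\<close> by the sum of the two costs.\<close>
        define w where "w = (l / (l + m)) *\<^sub>R z + (m / (l + m)) *\<^sub>R y"
        have one: "l / (l + m) + m / (l + m) = 1"
          using lm by (simp flip: add_divide_distrib)
        have w: "w \<in> D"
          using F p q lm one unfolding convex_on_def w_def by (intro convexD) auto
        have Fw: "F w \<le> (l / (l + m)) * F z + (m / (l + m)) * F y"
        proof -
          have conv: "F (a *\<^sub>R z + b *\<^sub>R y) \<le> a * F z + b * F y" if "a \<ge> 0" "b \<ge> 0" "a + b = 1" for a b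
            using F p q that unfolding convex_on_def by blast
          show ?thesis unfolding w_def by (rule conv[OF _ _ one]) (use p q lm in auto)
        qed
        have "(l + m) * F w \<le> (l + m) * ((l / (l + m)) * F z + (m / (l + m)) * F y)"
          using Fw lm by (intro mult_left_mono) auto
        also have "\<dots> = l * F z + m * F y"
          using lm by (simp add: distrib_left)
        finally have Fw': "(l + m) * F w \<le> l * F z + m * F y" .
        have "(l + m) *\<^sub>R w = l *\<^sub>R z + m *\<^sub>R y"
          using lm by (simp add: w_def scaleR_add_right)
        then have jw: "(l + m) *\<^sub>R j w = l *\<^sub>R j z + m *\<^sub>R j y"
          by (metis j linear_add linear_scale)
        have "T (u + v) \<le> h (u + v) (l + m, w)"
          using w lm by (intro le) (auto simp: I_def)
        also have "\<dots> = S ((u + l *\<^sub>R j z) + (v + m *\<^sub>R j y)) + (l + m) * F w"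
          by (simp add: h_def jw ac_simps)
        also have "\<dots> \<le> S (u + l *\<^sub>R j z) + S (v + m *\<^sub>R j y) + (l * F z + m * F y)"
          using sublinear_add[OF S] Fw' by (intro add_mono) auto
        finally show ?thesis by (simp add: h_def p q)
      qed
    qed
    \<comment> \<open>The two infima are taken in turn, first over the index belonging to
      \<open>v\<close>, then over the one belonging to \<open>u\<close>.\<close>
    have "T (u + v) - T v \<le> h u p" if p: "p \<in> I" for p
    proof -
      have "T (u + v) - h u p \<le> T v"
        using *[OF p] by (intro ge) (simp add: algebra_simps)
      then show ?thesis by simp
    qed
    then have "T (u + v) - T v \<le> T u"
      by (rule ge)
    then show "T (u + v) \<le> T u + T v" by simp
  qed
qed

text \<open>Minimality supplies oddness, which turns subadditivity into additivity and extends
  homogeneity to negative scalars.\<close>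

lemma minimal_sublinear_is_linear:
  assumes S: "sublinear S"
    and min: "\<And>T. sublinear T \<Longrightarrow> (\<And>u. T u \<le> S u) \<Longrightarrow> T = S"
  shows "linear S"
proof -
  have odd: "S (- v) = - S v" for v
  proof -
    obtain T where T: "sublinear T" "\<And>u. T u \<le> S u"
      and Tv: "\<And>z. z \<in> {v} \<Longrightarrow> T (- id z) \<le> - S z"
    proof (rule sublinear_lower_hull[OF S linear_id, of "{v}" "\<lambda>z. - S z"])
    qed (auto intro: convex_on_singleton)
    have "T = S" using T by (rule min)
    then have "S (- v) \<le> - S v" using Tv by simp
    with sublinear_minus[OF S, of v] show ?thesis by simp
  qed
  have add: "S (u + v) = S u + S v" for u v
  proof -
    have "S u \<le> S (u + v) + S (- v)"
      using sublinear_add[OF S, of "u + v" "- v"] by simp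
    then show ?thesis using sublinear_add[OF S, of u v] odd[of v] by simp
  qed
  show ?thesis
  proof (rule linearI)
    fix c u
    show "S (c *\<^sub>R u) = c *\<^sub>R S u"
      using sublinear_scale[OF S, of c u] sublinear_scale[OF S, of "- c" u] odd[of "c *\<^sub>R u"]
      by (cases "c \<ge> 0") auto
  qed (rule add)
qed

text \<open>The bound \<open>- S (- u)\<close> keeps the infimum finite. Subadditivity needs
  comparability: the smaller of \<open>T\<close> and \<open>T'\<close>, evaluated at
  \<open>u + v\<close>, is at most \<open>T u + T' v\<close>.\<close>

lemma sublinear_INF_chain:
  assumes \<C>: "\<C> \<noteq> {}" "\<And>T. T \<in> \<C> \<Longrightarrow> sublinear T" "\<And>T u. T \<in> \<C> \<Longrightarrow> T u \<le> S u"
    and chain: "\<And>T T'. T \<in> \<C> \<Longrightarrow> T' \<in> \<C> \<Longrightarrow> (\<forall>u. T u \<le> T' u) \<or> (\<forall>u. T' u \<le> T u)"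
  shows "sublinear (\<lambda>u. INF T\<in>\<C>. T u)" "T \<in> \<C> \<Longrightarrow> (INF T\<in>\<C>. T u) \<le> T u"
proof -
  have "- S (- u) \<le> T u" if "T \<in> \<C>" for T u
    using sublinear_minus[OF \<C>(2)[OF that], of u] \<C>(3)[OF that, of "- u"] by simp
  then have bdd: "bdd_below ((\<lambda>T. T u) ` \<C>)" for u
    by (intro bdd_belowI2[where m = "- S (- u)"])
  have le: "(INF T\<in>\<C>. T u) \<le> T u" if "T \<in> \<C>" for T u
    using bdd that by (rule cINF_lower)
  have ge: "c \<le> (INF T\<in>\<C>. T u)" if "\<And>T. T \<in> \<C> \<Longrightarrow> c \<le> T u" for c u
    using \<C>(1) that by (rule cINF_greatest)
  show "T \<in> \<C> \<Longrightarrow> (INF T\<in>\<C>. T u) \<le> T u" by (rule le)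
  show "sublinear (\<lambda>u. INF T\<in>\<C>. T u)"
  proof (rule sublinearI)
    show "(INF T\<in>\<C>. T 0) = 0"
      using \<C>(1) by (simp add: sublinear_zero[OF \<C>(2)] cong: INF_cong)
  next
    fix c :: real and u assume c: "c > 0"
    have "inverse c * (INF T\<in>\<C>. T (c *\<^sub>R u)) \<le> (INF T\<in>\<C>. T u)"
    proof (rule ge)
      fix T assume T: "T \<in> \<C>"
      then show "inverse c * (INF T\<in>\<C>. T (c *\<^sub>R u)) \<le> T u"
        using le[OF T, of "c *\<^sub>R u"] sublinear_scale[OF \<C>(2)[OF T], of c u] c
        by (simp add: field_simps)
    qed
    then show "(INF T\<in>\<C>. T (c *\<^sub>R u)) \<le> c * (INF T\<in>\<C>. T u)"
      using c by (simp add: field_simps)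
  next
    fix u v
    have *: "(INF T\<in>\<C>. T (u + v)) \<le> T u + T' v" if T: "T \<in> \<C>" and T': "T' \<in> \<C>" for T T'
      using chain[OF T T']
    proof
      assume "\<forall>u. T u \<le> T' u"
      then have "T v \<le> T' v" by blast
      then show ?thesis
        using le[OF T, of "u + v"] sublinear_add[OF \<C>(2)[OF T], of u v] by linarith
    next
      assume "\<forall>u. T' u \<le> T u"
      then have "T' u \<le> T u" by blast
      then show ?thesis
        using le[OF T', of "u + v"] sublinear_add[OF \<C>(2)[OF T'], of u v] by linarith
    qed
    have "(INF T\<in>\<C>. T (u + v)) - (INF T\<in>\<C>. T v) \<le> T u" if T: "T \<in> \<C>" for T
    proof -
      have "(INF T\<in>\<C>. T (u + v)) - T u \<le> (INF T\<in>\<C>. T v)"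
        using *[OF T] by (intro ge) (simp add: algebra_simps)
      then show ?thesis by simp
    qed
    then have "(INF T\<in>\<C>. T (u + v)) - (INF T\<in>\<C>. T v) \<le> (INF T\<in>\<C>. T u)"
      by (rule ge)
    then show "(INF T\<in>\<C>. T (u + v)) \<le> (INF T\<in>\<C>. T u) + (INF T\<in>\<C>. T v)" by simp
  qed
qed

text \<open>Zorn's lemma gives a minimal element among the sublinear functionals below
  \<open>S\<close>. It is then minimal among all sublinear functionals, hence linear.\<close>

lemma linear_below_sublinear:
  fixes S :: "'a::real_vector \<Rightarrow> real"
  assumes S: "sublinear S"
  obtains L where "linear L" "\<And>u. L u \<le> S u"
proof -
  define A where "A = {T. sublinear T \<and> (\<forall>u. T u \<le> S u)}"
  \<comment> \<open>The order is reversed, so that chains are bounded by their infima and maximal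
    elements are minimal functionals.\<close>
  define P where "P = (\<lambda>(T::'a \<Rightarrow> real) T'. \<forall>u. T' u \<le> T u)"
  have "\<exists>m\<in>A. \<forall>a\<in>A. P m a \<longrightarrow> a = m"
  proof (rule predicate_Zorn)
    show "partial_order_on A (relation_of P A)"
      by (rule partial_order_on_relation_ofI)
        (auto simp: P_def intro: order_trans intro!: ext antisym)
  next
    fix \<C> assume "\<C> \<in> Chains (relation_of P A)"
    then have sub: "\<C> \<subseteq> A"
      and chain: "\<And>T T'. T \<in> \<C> \<Longrightarrow> T' \<in> \<C> \<Longrightarrow> P T T' \<or> P T' T"
      by (auto simp: Chains_def relation_of_def)
    show "\<exists>U\<in>A. \<forall>T\<in>\<C>. P T U"
    proof (cases "\<C> = {}")
      case True
      then show ?thesis using S by (auto simp: A_def)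
    next
      case False
      have inA: "\<And>T. T \<in> \<C> \<Longrightarrow> sublinear T" "\<And>T u. T \<in> \<C> \<Longrightarrow> T u \<le> S u"
        using sub by (auto simp: A_def)
      have ch: "(\<forall>u. T u \<le> T' u) \<or> (\<forall>u. T' u \<le> T u)" if "T \<in> \<C>" "T' \<in> \<C>" for T T'
        using chain[OF that] unfolding P_def by blast
      define U where "U = (\<lambda>u. INF T\<in>\<C>. T u)"
      have U: "sublinear U" "\<And>T u. T \<in> \<C> \<Longrightarrow> U u \<le> T u"
      proof -
        show "sublinear U"
          unfolding U_def using False inA ch by (rule sublinear_INF_chain(1))
        show "U u \<le> T u" if "T \<in> \<C>" for T u
          unfolding U_def using False inA ch that by (rule sublinear_INF_chain(2))
      qed
      obtain T where "T \<in> \<C>" using False by blast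
      then have "U u \<le> S u" for u
        using U(2)[of T u] inA(2)[of T u] by linarith
      with U show ?thesis by (intro bexI[of _ U]) (auto simp: A_def P_def)
    qed
  qed
  then obtain L where L: "L \<in> A" and min: "\<And>T. T \<in> A \<Longrightarrow> P L T \<Longrightarrow> T = L" by blast
  have "linear L"
  proof (rule minimal_sublinear_is_linear)
    show "sublinear L" using L by (simp add: A_def)
    fix T assume T: "sublinear T" "\<And>u. T u \<le> L u"
    moreover have "T u \<le> S u" for u
      using T(2)[of u] L by (auto simp: A_def intro: order_trans)
    ultimately show "T = L" by (intro min) (auto simp: A_def P_def)
  qed
  with L show thesis by (intro that) (auto simp: A_def)
qed

text \<open>The constraint is first absorbed into a smaller sublinear \<open>T\<close>. Any linear
  \<open>L \<le> T\<close> then has \<open>L (- j z) \<le> T (- j z) \<le> F z\<close>, which is the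
  multiplier inequality.\<close>

theorem Hahn_Banach_Lagrange:
  fixes S :: "'a::real_vector \<Rightarrow> real" and j :: "'z::real_vector \<Rightarrow> 'a"
  assumes S: "sublinear S" and j: "linear j" and F: "convex_on D F" and "D \<noteq> {}"
    and nonneg: "\<And>z. z \<in> D \<Longrightarrow> 0 \<le> F z + S (j z)"
  obtains L where "linear L" "\<And>u. L u \<le> S u" "\<And>z. z \<in> D \<Longrightarrow> 0 \<le> F z + L (j z)"
proof -
  obtain T where T: "sublinear T" "\<And>u. T u \<le> S u" "\<And>z. z \<in> D \<Longrightarrow> T (- j z) \<le> F z"
    using sublinear_lower_hull[OF assms] by blast
  obtain L where L: "linear L" "\<And>u. L u \<le> T u"
    using linear_below_sublinear[OF T(1)] by blast
  show thesis
  proof (rule that[OF L(1)])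
    show "L u \<le> S u" for u using L(2) T(2) by (rule order_trans)
    show "0 \<le> F z + L (j z)" if "z \<in> D" for z
      using L(2)[of "- j z"] T(3)[OF that] linear_neg[OF L(1), of "j z"] by linarith
  qed
qed

section \<open>Continuous multipliers dominated by a norm\<close>

lemma sublinear_norm: "0 \<le> K \<Longrightarrow> sublinear (\<lambda>u::'a::real_normed_vector. K * norm u)"
  by (rule sublinearI) (auto simp: distrib_left[symmetric] norm_triangle_ineq intro: mult_left_mono)

theorem norm_Lagrange_multiplier:
  fixes j :: "'z::real_vector \<Rightarrow> 'a::real_normed_vector"
  assumes K: "0 \<le> K" and j: "linear j" and F: "convex_on D F" and "D \<noteq> {}"
    and nonneg: "\<And>z. z \<in> D \<Longrightarrow> 0 \<le> F z + K * norm (j z)"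
  obtains \<xi> :: "'a \<Rightarrow>\<^sub>L real"
  where "\<And>u. blinfun_apply \<xi> u \<le> K * norm u" "\<And>z. z \<in> D \<Longrightarrow> 0 \<le> F z + blinfun_apply \<xi> (j z)"
proof -
  obtain L where L: "linear L" "\<And>u. L u \<le> K * norm u" "\<And>z. z \<in> D \<Longrightarrow> 0 \<le> F z + L (j z)"
    using Hahn_Banach_Lagrange[OF sublinear_norm[OF K] j F \<open>D \<noteq> {}\<close> nonneg] by blast
  have "norm (L u) \<le> norm u * K" for u
    using L(2)[of u] L(2)[of "- u"] linear_neg[OF L(1), of u] by (simp add: abs_le_iff mult.commute)
  then have "bounded_linear L"
    using L(1) by (intro bounded_linear_intro[where K = K]) (auto simp: linear_add linear_scale)
  with L show thesis by (intro that[of "Blinfun L"]) (simp_all add: bounded_linear_Blinfun_apply)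
qed

lemma norming_functional:
  fixes u :: "'a::real_normed_vector"
  obtains \<xi> :: "'a \<Rightarrow>\<^sub>L real" where "norm \<xi> \<le> 1" "blinfun_apply \<xi> u = norm u"
proof -
  obtain \<xi> :: "'a \<Rightarrow>\<^sub>L real"
    where \<xi>: "\<And>v. blinfun_apply \<xi> v \<le> 1 * norm v"
      "\<And>z. z \<in> {- u} \<Longrightarrow> 0 \<le> - norm z + blinfun_apply \<xi> (- z)"
  \<comment> \<open>On the single point \<open>- u\<close> the multiplier inequality reads
    \<open>norm u \<le> \<xi> u\<close>; the reverse comes from the domination by the norm.\<close>
  proof (rule norm_Lagrange_multiplier[of 1 "\<lambda>z. - z" "{- u}" "\<lambda>z. - norm z"])
    show "linear (\<lambda>z::'a. - z)" by (simp add: linear_iff)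
  qed (auto intro: convex_on_singleton)
  have "norm \<xi> \<le> 1"
  proof (rule norm_blinfun_bound)
    show "norm (blinfun_apply \<xi> v) \<le> 1 * norm v" for v
      using \<xi>(1)[of v] \<xi>(1)[of "- v"] by (simp add: abs_le_iff blinfun.minus_right)
  qed simp
  moreover have "blinfun_apply \<xi> u = norm u"
    using \<xi>(1)[of u] \<xi>(2)[of "- u"] by (simp add: blinfun.minus_right)
  ultimately show thesis by (rule that)
qed

section \<open>Convex series and Baire category\<close>

text \<open>The weights \<open>1/2, 1/4, ..., (1/2)^n\<close> and the remainder
  \<open>(1/2)^n\<close> sum to 1. The induction step hands the remainder to the midpoint of
  \<open>c n\<close> and \<open>d\<close>, hence the arbitrary \<open>d\<close>.\<close>

lemma convex_series_partial:
  assumes "convex C" "\<And>k. c k \<in> C" "d \<in> C"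
  shows "(\<Sum>k<n. (1/2::real) ^ Suc k *\<^sub>R c k) + (1/2) ^ n *\<^sub>R d \<in> C"
  using assms(3)
proof (induction n arbitrary: d)
  case (Suc n)
  have "(1/2) *\<^sub>R c n + (1/2) *\<^sub>R d \<in> C"
    using assms(1,2) Suc.prems by (intro convexD) auto
  from Suc.IH[OF this] show ?case
    by (simp add: scaleR_add_right add.assoc mult.commute)
qed simp

lemma convex_series_mem:
  fixes c :: "nat \<Rightarrow> 'a::real_normed_vector"
  assumes "convex C" "closed C" "\<And>k. c k \<in> C"
    and sums: "(\<lambda>k. (1/2::real) ^ Suc k *\<^sub>R c k) sums s"
  shows "s \<in> C"
proof -
  \<comment> \<open>Giving the remaining weight to \<open>c 0\<close> keeps each partial sum in
    \<open>C\<close> without changing the limit.\<close>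
  have "(\<lambda>n. (1/2::real) ^ n *\<^sub>R c 0) \<longlonglongrightarrow> 0 *\<^sub>R c 0"
    by (intro tendsto_intros LIMSEQ_realpow_zero) auto
  then have "(\<lambda>n. (\<Sum>k<n. (1/2::real) ^ Suc k *\<^sub>R c k) + (1/2) ^ n *\<^sub>R c 0) \<longlonglongrightarrow> s + 0 *\<^sub>R c 0"
    using sums unfolding sums_def by (intro tendsto_add)
  then have "(\<lambda>n. (\<Sum>k<n. (1/2::real) ^ Suc k *\<^sub>R c k) + (1/2) ^ n *\<^sub>R c 0) \<longlonglongrightarrow> s"
    by simp
  then show ?thesis
    by (rule closed_sequentially[OF assms(2) convex_series_partial[OF assms(1,3,3)]])
qed

text \<open>Successive approximation as in the open mapping theorem: each residual is approximated
  to within \<open>\<delta> / 2\<close> and doubled, so it stays in the ball. The chosen points form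
  a convex series, convergent because \<open>C\<close> is bounded and the domain complete, and its
  sum is a preimage of \<open>v\<close> in \<open>C\<close>.\<close>

lemma ball_subset_image_of_closure:
  fixes A :: "'a::banach \<Rightarrow> 'b::real_normed_vector"
  assumes A: "bounded_linear A" and L: "subspace L"
    and C: "closed C" "convex C" "bounded C" "A ` C \<subseteq> L"
    and dense: "\<And>v. v \<in> L \<Longrightarrow> norm v < \<delta> \<Longrightarrow> v \<in> closure (A ` C)" and "0 < \<delta>"
    and v: "v \<in> L" "norm v < \<delta> / 2"
  shows "v \<in> A ` C"
proof -
  interpret A: bounded_linear A by (rule A)
  have "\<exists>c\<in>C. norm (u - A c) < \<delta> / 2" if "u \<in> L" "norm u < \<delta>" for u
  proof -
    obtain y where "y \<in> A ` C" "dist y u < \<delta> / 2"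
      using dense[of u] \<open>u \<in> L\<close> \<open>norm u < \<delta>\<close> \<open>0 < \<delta>\<close> unfolding closure_approachable by (metis half_gt_zero)
    then show ?thesis by (auto simp: dist_norm norm_minus_commute)
  qed
  then obtain c where c: "\<And>u. u \<in> L \<Longrightarrow> norm u < \<delta> \<Longrightarrow> c u \<in> C \<and> norm (u - A (c u)) < \<delta> / 2"
    by metis
  \<comment> \<open>The rescaled residual: \<open>(1/2) ^ Suc n *\<^sub>R w n\<close> is what
    remains of \<open>v\<close> after \<open>n\<close> terms. The start \<open>2 *\<^sub>R v\<close>
    has norm below \<open>\<delta>\<close>, which explains the radius
    \<open>\<delta> / 2\<close>.\<close>
  define w where "w = rec_nat (2 *\<^sub>R v) (\<lambda>_ u. 2 *\<^sub>R (u - A (c u)))"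
  have w_simps: "w 0 = 2 *\<^sub>R v" "w (Suc n) = 2 *\<^sub>R (w n - A (c (w n)))" for n
    by (simp_all add: w_def)
  have w: "w n \<in> L \<and> norm (w n) < \<delta>" for n
  proof (induction n)
    case 0
    then show ?case using v L by (simp add: w_simps subspace_scale)
  next
    case (Suc n)
    then have "A (c (w n)) \<in> L" "norm (w n - A (c (w n))) < \<delta> / 2"
      using c[of "w n"] C(4) by auto
    then show ?case
      using Suc L by (simp add: w_simps subspace_scale subspace_diff)
  qed
  have cw: "c (w n) \<in> C" for n using c w by blast
  obtain B where B: "\<And>z. z \<in> C \<Longrightarrow> norm z \<le> B"
    using C(3) by (auto simp: bounded_iff)
  have "summable (\<lambda>k. (1/2::real) ^ Suc k *\<^sub>R c (w k))"
  proof (rule summable_comparison_test')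
    show "summable (\<lambda>k. (1/2::real) ^ Suc k * B)"
      by (intro summable_mult2) (simp add: summable_geometric)
    show "norm ((1/2::real) ^ Suc k *\<^sub>R c (w k)) \<le> (1/2) ^ Suc k * B" if "k \<ge> 0" for k
      using B[OF cw[of k]] by (simp add: mult_left_mono)
  qed
  then obtain s where s: "(\<lambda>k. (1/2::real) ^ Suc k *\<^sub>R c (w k)) sums s"
    by (auto simp: summable_def)
  have "s \<in> C" using convex_series_mem[OF C(2,1) cw s] .
  have part: "(\<Sum>k<n. (1/2::real) ^ Suc k *\<^sub>R A (c (w k))) = v - (1/2) ^ Suc n *\<^sub>R w n" for n
    by (induction n) (simp_all add: w_simps algebra_simps)
  have "(\<lambda>n. v - (1/2::real) ^ Suc n *\<^sub>R w n) \<longlonglongrightarrow> A s"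
    using A.sums[OF s] unfolding sums_def by (simp only: A.scaleR part)
  moreover have "(\<lambda>n. v - (1/2::real) ^ Suc n *\<^sub>R w n) \<longlonglongrightarrow> v - 0"
  proof (intro tendsto_diff tendsto_const)
    show "(\<lambda>n. (1/2::real) ^ Suc n *\<^sub>R w n) \<longlonglongrightarrow> 0"
    proof (rule Lim_null_comparison)
      show "\<forall>\<^sub>F n in sequentially. norm ((1/2::real) ^ Suc n *\<^sub>R w n) \<le> (1/2) ^ Suc n * \<delta>"
        using w by (intro always_eventually allI) (simp add: less_imp_le)
      have "(\<lambda>n. (1/2::real) ^ Suc n * \<delta>) \<longlonglongrightarrow> 0 * \<delta>"
        by (intro tendsto_intros LIMSEQ_Suc LIMSEQ_realpow_zero) auto
      then show "(\<lambda>n. (1/2::real) ^ Suc n * \<delta>) \<longlonglongrightarrow> 0" by simp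
    qed
  qed
  ultimately have "A s = v" using LIMSEQ_unique by fastforce
  with \<open>s \<in> C\<close> show ?thesis by blast
qed

text \<open>Baire's theorem is applied in the relative topology of \<open>L\<close>, which is
  completely metrizable because \<open>L\<close> is closed; \<open>L\<close> itself may have empty
  interior in the whole space.\<close>

lemma closed_subspace_Baire:
  fixes L :: "'a::banach set"
  assumes L: "closed L" "subspace L" and cov: "L \<subseteq> (\<Union>n. X n)"
    and X: "\<And>n::nat. closed (X n)"
  obtains n u \<epsilon> where "u \<in> L" "0 < \<epsilon>" "L \<inter> ball u \<epsilon> \<subseteq> X n"
proof -
  let ?T = "top_of_set L"
  have "completely_metrizable_space ?T"
    using L(1) by (intro completely_metrizable_space_closedin completely_metrizable_space_euclidean) auto
  moreover have "\<not> ?T interior_of (\<Union>n. L \<inter> X n) = {}"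
  proof -
    have "(\<Union>n. L \<inter> X n) = L" using cov by blast
    moreover have "?T interior_of L = L"
      using interior_of_topspace[of ?T] by simp
    ultimately show ?thesis using subspace_0[OF L(2)] by auto
  qed
  ultimately have "\<not> (\<forall>T\<in>range (\<lambda>n. L \<inter> X n). closedin ?T T \<and> ?T interior_of T = {})"
    using Baire_category_alt[of ?T "range (\<lambda>n. L \<inter> X n)"] by (metis countableI_type countable_image)
  then obtain n where "?T interior_of (L \<inter> X n) \<noteq> {}"
    using X by (auto simp: closedin_closed_Int)
  then obtain u U where U: "openin ?T U" "u \<in> U" "U \<subseteq> L \<inter> X n"
    by (auto simp: interior_of_def)
  then obtain \<epsilon> where "\<epsilon> > 0" "ball u \<epsilon> \<inter> L \<subseteq> U"
    by (auto simp: openin_contains_ball)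
  with U show thesis by (intro that[of u \<epsilon> n]) auto
qed

text \<open>A Robinson--Ursescu theorem: Baire category puts a ball into the closure of some \<^term>\<open>A ` C n\<close>,
  and summing convex series removes the closure.\<close>

theorem ball_subset_image_of_exhaustion:
  fixes A :: "'a::banach \<Rightarrow> 'b::banach" and C :: "nat \<Rightarrow> 'a set"
  assumes A: "bounded_linear A" and L: "subspace L" "closed L"
    and C: "\<And>n. closed (C n)" "\<And>n. convex (C n)" "\<And>n. bounded (C n)" "incseq C"
    and L_eq: "L = (\<Union>r\<in>{0<..}. (*\<^sub>R) r ` A ` (\<Union>n. C n))"
  obtains n \<delta> where "0 < \<delta>" "\<And>v. v \<in> L \<Longrightarrow> norm v < \<delta> \<Longrightarrow> v \<in> A ` C n"
proof -
  interpret A: bounded_linear A by (rule A)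
  have CL: "A ` C n \<subseteq> L" for n
    unfolding L_eq by (rule subsetI, rule UN_I[of 1]) auto
  have mono: "C m \<subseteq> C n" if "m \<le> n" for m n using C(4) that by (simp add: incseq_def)
  have convAC: "convex (A ` C n)" for n
    using C(2) A.linear by (rule convex_linear_image[rotated])
  have "0 \<in> L" using L(1) by (rule subspace_0)
  then obtain n0 where n0: "0 \<in> A ` C n0"
    unfolding L_eq by (auto simp: image_iff)
  \<comment> \<open>With this shift the index of \<open>C\<close> equals the dilation factor
    \<open>real (Suc n)\<close>, which is never zero.\<close>
  define B where "B n = A ` C (Suc n)" for n
  have B_mono: "B m \<subseteq> B n" if "m \<le> n" for m n
    unfolding B_def using mono[of "Suc m" "Suc n"] that by (simp add: image_mono)
  have absorb: "\<exists>n. v \<in> (*\<^sub>R) (real (Suc n)) ` B n" if "v \<in> L" for v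
  proof -
    obtain r m z where r: "r > 0" "z \<in> C m" "v = r *\<^sub>R A z"
      using \<open>v \<in> L\<close> unfolding L_eq by auto
    obtain k where k: "r \<le> real k" using real_arch_simple by blast
    define n where "n = max (max m n0) k"
    have n: "m \<le> Suc n" "n0 \<le> Suc n" "k \<le> Suc n" by (auto simp: n_def)
    have "r \<le> real (Suc n)" using k n by linarith
    then have rn: "r / real (Suc n) \<le> 1" by simp
    have "(r / real (Suc n)) *\<^sub>R A z + (1 - r / real (Suc n)) *\<^sub>R 0 \<in> A ` C (Suc n)"
    proof (rule convexD[OF convAC])
      show "A z \<in> A ` C (Suc n)" using r(2) mono[OF n(1)] by blast
      show "0 \<in> A ` C (Suc n)" using n0 mono[OF n(2)] by blast
    qed (use r rn in auto)
    then have "(r / real (Suc n)) *\<^sub>R A z \<in> B n" unfolding B_def by simp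
    moreover have "v = real (Suc n) *\<^sub>R ((r / real (Suc n)) *\<^sub>R A z)" using r by simp
    ultimately have "v \<in> (*\<^sub>R) (real (Suc n)) ` B n" by (rule image_eqI[rotated])
    then show ?thesis by (rule exI)
  qed
  have "L \<subseteq> (\<Union>n. (*\<^sub>R) (real (Suc n)) ` closure (B n))"
  proof
    fix v assume "v \<in> L"
    obtain n where "v \<in> (*\<^sub>R) (real (Suc n)) ` B n" using absorb[OF \<open>v \<in> L\<close>] by (rule exE)
    then have "v \<in> (*\<^sub>R) (real (Suc n)) ` closure (B n)"
      using image_mono[OF closure_subset[of "B n"]] by (rule subsetD[rotated])
    then show "v \<in> (\<Union>n. (*\<^sub>R) (real (Suc n)) ` closure (B n))"
      by (rule UN_I[OF UNIV_I])
  qed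
  moreover have "closed ((*\<^sub>R) (real (Suc n)) ` closure (B n))" for n
    by (simp only: closure_scaleR closed_closure)
  ultimately obtain n u \<epsilon> where u: "u \<in> L" "0 < \<epsilon>"
    and ball: "L \<inter> ball u \<epsilon> \<subseteq> (*\<^sub>R) (real (Suc n)) ` closure (B n)"
    by (rule closed_subspace_Baire[OF L(2,1)])
  obtain m where "- u \<in> (*\<^sub>R) (real (Suc m)) ` B m"
    using absorb[OF subspace_neg[OF L(1) u(1)]] by (rule exE)
  then obtain b where b: "- u = real (Suc m) *\<^sub>R b" "b \<in> B m" by (rule imageE)
  define p where "p = max m n"
  define a where "a = real (Suc n)"
  define d where "d = real (Suc m)"
  \<comment> \<open>The ball around \<open>u\<close> is moved to the origin: with
    \<open>a *\<^sub>R y = u + (a + d) *\<^sub>R v\<close> and \<open>d *\<^sub>R b = - u\<close>,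
    the vector \<open>v\<close> is the convex combination of \<open>y\<close> and \<open>b\<close>
    with weights \<open>a / (a + d)\<close> and \<open>d / (a + d)\<close>.\<close>
  define \<delta> where "\<delta> = \<epsilon> / (a + d)"
  have ad: "a > 0" "d > 0" by (simp_all add: a_def d_def)
  have "\<delta> > 0" using u(2) ad by (simp add: \<delta>_def)
  have dense: "v \<in> closure (A ` C (Suc p))" if v: "v \<in> L" "norm v < \<delta>" for v
  proof -
    have "norm ((a + d) *\<^sub>R v) < \<epsilon>"
    proof -
      have "norm ((a + d) *\<^sub>R v) = (a + d) * norm v" using ad by simp
      also have "\<dots> < (a + d) * \<delta>" using v(2) ad by (intro mult_strict_left_mono) auto
      finally show ?thesis using ad by (simp add: \<delta>_def)
    qed
    then have "u + (a + d) *\<^sub>R v \<in> L \<inter> ball u \<epsilon>"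
      using u(1) v(1) L(1) by (simp add: subspace_add subspace_scale dist_norm)
    then obtain y where y: "u + (a + d) *\<^sub>R v = a *\<^sub>R y" "y \<in> closure (B n)"
      using subsetD[OF ball] unfolding a_def by (meson imageE)
    have "y \<in> closure (B p)"
      by (rule subsetD[OF closure_mono[OF B_mono] y(2)]) (simp add: p_def)
    moreover have "b \<in> closure (B p)"
      by (rule subsetD[OF closure_subset], rule subsetD[OF B_mono b(2)]) (simp add: p_def)
    ultimately
    have "(a / (a + d)) *\<^sub>R y + (d / (a + d)) *\<^sub>R b \<in> closure (B p)"
      using convAC ad unfolding B_def
      by (intro convexD[OF convex_closure]) (auto simp flip: add_divide_distrib)
    moreover have "(a / (a + d)) *\<^sub>R y + (d / (a + d)) *\<^sub>R b = (1 / (a + d)) *\<^sub>R (a *\<^sub>R y + d *\<^sub>R b)"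
      by (simp add: scaleR_add_right)
    moreover have "a *\<^sub>R y + d *\<^sub>R b = (a + d) *\<^sub>R v"
    proof -
      have "d *\<^sub>R b = - u" using b(1) by (simp add: d_def)
      moreover have "a *\<^sub>R y = u + (a + d) *\<^sub>R v" using y(1) by simp
      ultimately show ?thesis by simp
    qed
    ultimately show ?thesis using ad by (simp add: B_def)
  qed
  show thesis
  proof (rule that)
    show "\<delta> / 2 > 0" using \<open>\<delta> > 0\<close> by simp
    show "v \<in> A ` C (Suc p)" if "v \<in> L" "norm v < \<delta> / 2" for v
      using A L(1) C(1,2,3) CL dense \<open>\<delta> > 0\<close> that by (rule ball_subset_image_of_closure)
  qed
qed

section \<open>Lagrange multipliers under a constraint qualification\<close>

text \<open>The bound \<open>N\<close> on a ball of constraint values, together with convexity,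
  makes the problem calm: \<open>F z\<close> is at least \<open>- K * norm (j z)\<close>. A
  multiplier dominated by \<open>K\<close> times the norm then exists.\<close>

theorem Lagrange_multiplier:
  fixes j :: "'z::real_vector \<Rightarrow> 'a::real_normed_vector"
  assumes j: "linear j" and F: "convex_on D F" and L: "subspace L" "j ` D \<subseteq> L"
    and "0 < \<delta>" and ball: "\<And>v. v \<in> L \<Longrightarrow> norm v < \<delta> \<Longrightarrow> \<exists>z\<in>D. j z = v \<and> F z \<le> N"
    and nonneg: "\<And>z. z \<in> D \<Longrightarrow> j z = 0 \<Longrightarrow> 0 \<le> F z"
  obtains \<xi> :: "'a \<Rightarrow>\<^sub>L real" where "\<And>z. z \<in> D \<Longrightarrow> 0 \<le> F z + blinfun_apply \<xi> (j z)"
proof -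
  define K where "K = 2 * \<bar>N\<bar> / \<delta>"
  have K: "0 \<le> K" using \<open>0 < \<delta>\<close> by (simp add: K_def)
  have "D \<noteq> {}" using ball[of 0] subspace_0[OF L(1)] \<open>0 < \<delta>\<close> by auto
  have "0 \<le> F z + K * norm (j z)" if z: "z \<in> D" for z
  proof (cases "j z = 0")
    case True
    then show ?thesis using nonneg[OF z] by simp
  next
    case False
    \<comment> \<open>This scale puts \<open>- (a *\<^sub>R j z)\<close> at norm
      \<open>\<delta> / 2\<close>, inside the ball. Mixing its preimage \<open>y\<close> with
      \<open>z\<close> in the ratio 1 to \<open>a\<close> cancels the constraint, so
      \<open>F y + a * F z \<ge> 0\<close>; moreover
      \<open>\<bar>N\<bar> / a = K * norm (j z)\<close>.\<close>
    define a where "a = \<delta> / (2 * norm (j z))"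
    have a: "a > 0" using False \<open>0 < \<delta>\<close> by (simp add: a_def)
    have "norm (- (a *\<^sub>R j z)) = \<delta> / 2"
      using False \<open>0 < \<delta>\<close> by (simp add: a_def)
    moreover have "- (a *\<^sub>R j z) \<in> L"
      using L z by (auto intro: subspace_neg subspace_scale)
    ultimately obtain y where y: "y \<in> D" "j y = - (a *\<^sub>R j z)" "F y \<le> N"
      using ball[of "- (a *\<^sub>R j z)"] \<open>0 < \<delta>\<close> by auto
    have one: "1 / (1 + a) + a / (1 + a) = 1"
      using a by (simp flip: add_divide_distrib)
    define x where "x = (1 / (1 + a)) *\<^sub>R y + (a / (1 + a)) *\<^sub>R z"
    have "x \<in> D"
      unfolding x_def using convex_on_imp_convex[OF F] y z a one by (intro convexD) auto
    moreover have "j x = 0"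
      using a by (simp add: x_def linear_add[OF j] linear_scale[OF j] y)
    ultimately have "0 \<le> F x" by (rule nonneg)
    also have "F x \<le> (1 / (1 + a)) * F y + (a / (1 + a)) * F z"
      unfolding x_def using F y(1) z a one unfolding convex_on_def by (metis divide_nonneg_pos add_pos_pos less_imp_le zero_less_one)
    also have "\<dots> = (F y + a * F z) / (1 + a)"
      by (simp add: add_divide_distrib)
    finally have "0 \<le> F y + a * F z"
      using a by (simp add: zero_le_divide_iff)
    then have "0 \<le> \<bar>N\<bar> + a * F z" using y(3) by linarith
    then have "0 \<le> (\<bar>N\<bar> + a * F z) / a" using a by simp
    also have "\<dots> = F z + K * norm (j z)"
      using a False \<open>0 < \<delta>\<close> by (simp add: K_def add_divide_distrib) (simp add: a_def)
    finally show ?thesis .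
  qed
  then show thesis
    using norm_Lagrange_multiplier[OF K j F \<open>D \<noteq> {}\<close>] that by metis
qed

section \<open>Convexity of the squared norm, and attainment of norms\<close>

lemma convex_on_linear_vimage:
  assumes "convex_on S F" "linear h"
  shows "convex_on (h -` S) (\<lambda>z. F (h z))"
  using assms convex_linear_vimage[of h S]
  by (auto simp: convex_on_def linear_add linear_scale)

lemma convex_on_norm_diff_square:
  "convex_on UNIV (\<lambda>x::'a::real_normed_vector. (norm (x - w))\<^sup>2)"
proof (rule convex_onI)
  fix t :: real and x y :: 'a
  assume t: "t > 0" "t < 1"
  have "(1 - t) *\<^sub>R x + t *\<^sub>R y - w = (1 - t) *\<^sub>R (x - w) + t *\<^sub>R (y - w)"
    by (simp add: algebra_simps)
  then have "norm ((1 - t) *\<^sub>R x + t *\<^sub>R y - w) \<le> (1 - t) * norm (x - w) + t * norm (y - w)"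
    using t by (metis abs_of_nonneg diff_ge_0_iff_ge less_imp_le norm_scaleR norm_triangle_ineq)
  then have "(norm ((1 - t) *\<^sub>R x + t *\<^sub>R y - w))\<^sup>2 \<le> ((1 - t) * norm (x - w) + t * norm (y - w))\<^sup>2"
    by (intro power_mono) auto
  also have "\<dots> \<le> (1 - t) * (norm (x - w))\<^sup>2 + t * (norm (y - w))\<^sup>2"
    using convex_onD[OF convex_power2, of t "norm (x - w)" "norm (y - w)"] t by simp
  finally show "(norm ((1 - t) *\<^sub>R x + t *\<^sub>R y - w))\<^sup>2 \<le> (1 - t) * (norm (x - w))\<^sup>2 + t * (norm (y - w))\<^sup>2" .
qed simp

text \<open>The easy direction of James's theorem: a functional norming \<open>\<phi>\<close> in the
  bidual is evaluation at some \<open>x\<close>, and a functional norming \<open>x\<close> shows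
  that \<open>x\<close> lies in the unit ball.\<close>

lemma reflexive_norm_attained:
  fixes \<phi> :: "'a::banach \<Rightarrow>\<^sub>L real"
  assumes "reflexive_space TYPE('a)"
  obtains x where "norm x \<le> 1" "blinfun_apply \<phi> x = norm \<phi>"
proof -
  obtain \<Phi> :: "('a \<Rightarrow>\<^sub>L real) \<Rightarrow>\<^sub>L real" where \<Phi>: "norm \<Phi> \<le> 1" "blinfun_apply \<Phi> \<phi> = norm \<phi>"
    by (rule norming_functional)
  obtain x where x: "\<And>\<psi>. blinfun_apply \<Phi> \<psi> = blinfun_apply \<psi> x"
    using assms unfolding reflexive_space_def by blast
  obtain \<psi> :: "'a \<Rightarrow>\<^sub>L real" where \<psi>: "norm \<psi> \<le> 1" "blinfun_apply \<psi> x = norm x"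
    by (rule norming_functional)
  have "norm x \<le> norm \<Phi> * norm \<psi>"
    using norm_blinfun[of \<Phi> \<psi>] x[of \<psi>] \<psi>(2) by simp
  also have "\<dots> \<le> 1" using \<Phi>(1) \<psi>(1) by (simp add: mult_le_one)
  finally show thesis using x[of \<phi>] \<Phi>(2) by (intro that) auto
qed

section \<open>BC-functions\<close>

lemma edom_iff:
  assumes "proper_fun f"
  shows "p \<in> edom f \<longleftrightarrow> f p \<noteq> \<infinity>" and "p \<in> edom f \<Longrightarrow> ereal (real_of_ereal (f p)) = f p"
proof -
  have "f p \<noteq> - \<infinity>" using assms unfolding proper_fun_def by blast
  then show "p \<in> edom f \<longleftrightarrow> f p \<noteq> \<infinity>" and "p \<in> edom f \<Longrightarrow> ereal (real_of_ereal (f p)) = f p"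
    by (cases "f p"; simp add: edom_def)+
qed

lemma edom_nonempty: "proper_fun f \<Longrightarrow> edom f \<noteq> {}"
  using edom_iff(1)[of f] unfolding proper_fun_def by blast

lemma convex_fun_imp_convex_on:
  assumes f: "proper_fun f" "convex_fun f"
  shows "convex_on (edom f) (\<lambda>p. real_of_ereal (f p))"
proof -
  have *: "(1 - t) *\<^sub>R x + t *\<^sub>R y \<in> edom f \<and> real_of_ereal (f ((1 - t) *\<^sub>R x + t *\<^sub>R y))
      \<le> (1 - t) * real_of_ereal (f x) + t * real_of_ereal (f y)"
    if "0 < t" "t < 1" "x \<in> edom f" "y \<in> edom f" for t x y
  proof -
    have "f ((1 - t) *\<^sub>R x + t *\<^sub>R y) \<le> ereal (1 - t) * f x + ereal t * f y"
      using f(2) that unfolding convex_fun_def by blast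
    also have "\<dots> = ereal ((1 - t) * real_of_ereal (f x) + t * real_of_ereal (f y))"
      using edom_iff(2)[OF f(1) that(3)] edom_iff(2)[OF f(1) that(4)]
      by (metis plus_ereal.simps(1) times_ereal.simps(1))
    finally have le: "f ((1 - t) *\<^sub>R x + t *\<^sub>R y) \<le> ereal ((1 - t) * real_of_ereal (f x) + t * real_of_ereal (f y))" .
    then have "(1 - t) *\<^sub>R x + t *\<^sub>R y \<in> edom f"
      using edom_iff(1)[OF f(1)] by auto
    moreover from this le show ?thesis
      using edom_iff(2)[OF f(1)] by (metis ereal_less_eq(3))
  qed
  show ?thesis
  proof (rule convex_onI)
    show "convex (edom f)"
      unfolding convex_alt
    proof (intro ballI allI impI)
      fix x y and t :: real
      assume "x \<in> edom f" "y \<in> edom f" "0 \<le> t \<and> t \<le> 1"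
      then show "(1 - t) *\<^sub>R x + t *\<^sub>R y \<in> edom f"
        using *[of t x y] by (cases "t = 0 \<or> t = 1") auto
    qed
  qed (use * in blast)
qed

lemma convex_sublevel:
  fixes f :: "'a::real_normed_vector \<times> ('a \<Rightarrow>\<^sub>L real) \<Rightarrow> ereal"
  assumes f: "proper_fun f" "convex_fun f"
  shows "convex {p. f p \<le> ereal c}"
proof -
  have eq: "{p. f p \<le> ereal c} = {p \<in> edom f. real_of_ereal (f p) \<le> c}"
  proof (rule set_eqI)
    fix p
    show "p \<in> {p. f p \<le> ereal c} \<longleftrightarrow> p \<in> {p \<in> edom f. real_of_ereal (f p) \<le> c}"
      using edom_iff[OF f(1), of p] by (cases "f p") auto
  qed
  show ?thesis
    unfolding eq convex_alt
  proof (clarify, intro conjI)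
    fix x y and t :: real
    assume A: "x \<in> edom f" "y \<in> edom f" "real_of_ereal (f x) \<le> c" "real_of_ereal (f y) \<le> c" "0 \<le> t" "t \<le> 1"
    note F = convex_fun_imp_convex_on[OF f]
    show "(1 - t) *\<^sub>R x + t *\<^sub>R y \<in> edom f"
      using convex_on_imp_convex[OF F] A by (simp add: convex_alt)
    have "real_of_ereal (f ((1 - t) *\<^sub>R x + t *\<^sub>R y)) \<le> (1 - t) * real_of_ereal (f x) + t * real_of_ereal (f y)"
      using convex_onD[OF F A(5,6,1,2)] .
    also have "\<dots> \<le> (1 - t) * c + t * c"
      using A by (intro add_mono mult_left_mono) auto
    finally show "real_of_ereal (f ((1 - t) *\<^sub>R x + t *\<^sub>R y)) \<le> c"
      by (simp add: algebra_simps)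
  qed
qed

text \<open>Points outside \<open>edom f\<close> contribute \<open>-\<infinity>\<close> to the
  supremum, so only real values need be bounded.\<close>

lemma conj_at_le:
  assumes "proper_fun f" and "\<And>p. p \<in> edom f \<Longrightarrow> bracket p m - real_of_ereal (f p) \<le> c"
  shows "conj_at f m \<le> ereal c"
  unfolding conj_at_def
proof (rule SUP_least)
  fix p
  show "ereal (bracket p m) - f p \<le> ereal c"
  proof (cases "p \<in> edom f")
    case True
    then show ?thesis
      using assms(2)[OF True] edom_iff(2)[OF assms(1) True] by (metis ereal_less_eq(3) ereal_minus(1))
  next
    case False
    then show ?thesis using edom_iff(1)[OF assms(1)] by simp
  qed
qed

text \<open>The hypothesis splits into separate suprema with
  \<open>\<alpha> + \<beta> \<le> c\<close>, and each conjugate is bounded by its supremum. The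
  chains \<open>qf a \<le> f a \<le> \<alpha>\<close> and
  \<open>qf b \<le> g b \<le> \<beta>\<close> collapse as soon as
  \<open>c \<le> qf a + qf b\<close>.\<close>

lemma mem_Pq_of_conj_sum_le:
  assumes f: "BC_function f" and g: "BC_function g"
    and le: "\<And>p r. p \<in> edom f \<Longrightarrow> r \<in> edom g \<Longrightarrow>
      (bracket p a - real_of_ereal (f p)) + (bracket r b - real_of_ereal (g r)) \<le> c"
  shows "qf a + qf b \<le> c" and "c \<le> qf a + qf b \<Longrightarrow> a \<in> Pq f \<and> b \<in> Pq g"
proof -
  define u where "u p = bracket p a - real_of_ereal (f p)" for p
  define v where "v r = bracket r b - real_of_ereal (g r)" for r
  define \<alpha> where "\<alpha> = (SUP p\<in>edom f. u p)"
  define \<beta> where "\<beta> = (SUP r\<in>edom g. v r)"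
  have pf: "proper_fun f" and pg: "proper_fun g" using f g by (auto simp: BC_function_def)
  note ne = edom_nonempty[OF pf] edom_nonempty[OF pg]
  have uv: "u p \<le> c - v r" if "p \<in> edom f" "r \<in> edom g" for p r
    using le[OF that] by (simp add: u_def v_def)
  \<comment> \<open>Fixing one point in each domain bounds the supremum over the other, so both are
    real numbers.\<close>
  obtain p0 r0 where "p0 \<in> edom f" "r0 \<in> edom g" using ne by blast
  have bdd_u: "bdd_above (u ` edom f)"
    using uv[OF _ \<open>r0 \<in> edom g\<close>] by (rule bdd_aboveI2)
  have bdd_v: "bdd_above (v ` edom g)"
    using uv[OF \<open>p0 \<in> edom f\<close>] by (intro bdd_aboveI2[where M = "c - u p0"]) (simp add: le_diff_eq add.commute)
  have \<alpha>: "u p \<le> \<alpha>" if "p \<in> edom f" for p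
    unfolding \<alpha>_def using bdd_u that by (rule cSUP_upper[rotated])
  have \<beta>: "v r \<le> \<beta>" if "r \<in> edom g" for r
    unfolding \<beta>_def using bdd_v that by (rule cSUP_upper[rotated])
  have "\<alpha> \<le> c - v r" if "r \<in> edom g" for r
    unfolding \<alpha>_def using ne uv that by (intro cSUP_least) auto
  then have "v r \<le> c - \<alpha>" if "r \<in> edom g" for r using that by (simp add: le_diff_eq add.commute)
  then have sum: "\<alpha> + \<beta> \<le> c"
    unfolding \<beta>_def using ne cSUP_least[of "edom g" v "c - \<alpha>"] by simp
  have "conj_at f a \<le> ereal \<alpha>" "conj_at g b \<le> ereal \<beta>"
    using \<alpha> \<beta> pf pg by (auto intro!: conj_at_le simp: u_def v_def)
  moreover have "conj_at f a \<ge> f a" "f a \<ge> ereal (qf a)" "conj_at g b \<ge> g b" "g b \<ge> ereal (qf b)"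
    using f g unfolding BC_function_def by blast+
  ultimately have fa: "ereal (qf a) \<le> f a" "f a \<le> ereal \<alpha>" and gb: "ereal (qf b) \<le> g b" "g b \<le> ereal \<beta>"
    by (auto intro: order_trans)
  then have q: "qf a \<le> \<alpha>" "qf b \<le> \<beta>"
    by (metis ereal_less_eq(3) order_trans)+
  with sum show "qf a + qf b \<le> c" by linarith
  assume "c \<le> qf a + qf b"
  with q sum have "\<alpha> = qf a" "\<beta> = qf b" by linarith+
  with fa gb show "a \<in> Pq f \<and> b \<in> Pq g" by (auto simp: Pq_def)
qed

section \<open>The quadratic form \<open>qf\<close> and its bracket\<close>

lemma bracket_simps [simp]: "bracket (x, s) (y, t) = blinfun_apply t x + blinfun_apply s y"
  by (simp add: bracket_def)

lemma qf_simps [simp]: "qf (x, s) = blinfun_apply s x"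
  by (simp add: qf_def)

lemma qf_diff: "qf (p - r) = qf p - bracket p r + qf r"
  by (cases p; cases r) (simp add: blinfun.bilinear_simps)

lemma qf_add_half_norm_square_nonneg: "0 \<le> qf p + ((norm (fst p))\<^sup>2 + (norm (snd p))\<^sup>2) / 2"
proof -
  have half: "0 \<le> c + t / 2" if "- k \<le> c" "2 * k \<le> t" for c k t :: real
    using that by linarith
  show ?thesis
  proof (rule half)
    show "- (norm (snd p) * norm (fst p)) \<le> qf p"
      using norm_blinfun[of "snd p" "fst p"] by (simp add: qf_def)
    show "2 * (norm (snd p) * norm (fst p)) \<le> (norm (fst p))\<^sup>2 + (norm (snd p))\<^sup>2"
      using sum_squares_bound[of "norm (fst p)" "norm (snd p)"] by (simp add: mult_ac)
  qed
qed

lemma bracket_le: "\<bar>bracket p r\<bar> \<le> norm (snd r) * norm (fst p) + norm (snd p) * norm (fst r)"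
  using norm_blinfun[of "snd r" "fst p"] norm_blinfun[of "snd p" "fst r"]
  by (simp add: bracket_def)

text \<open>At the midpoint \<open>m\<close> convexity gives
  \<open>qf m \<le> f m \<le> (qf p + qf r) / 2\<close>. Expanding \<open>4 * qf m\<close> turns
  this into \<open>bracket p r \<le> qf p + qf r\<close>.\<close>

lemma Pq_monotone:
  assumes f: "BC_function f" and p: "p \<in> Pq f" and r: "r \<in> Pq f"
  shows "0 \<le> qf (p - r)"
proof -
  define m where "m = (1 - 1/2) *\<^sub>R p + (1/2::real) *\<^sub>R r"
  have "ereal (qf m) \<le> f m" using f unfolding BC_function_def by blast
  also have "f m \<le> ereal (1 - 1/2) * f p + ereal (1/2) * f r"
  proof -
    have "convex_fun f" using f unfolding BC_function_def by blast
    then show ?thesis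
      unfolding m_def by (rule convex_fun_def[THEN iffD1, rule_format]) simp
  qed
  also have "\<dots> = ereal (qf p / 2 + qf r / 2)"
    using p r by (simp add: Pq_def)
  finally have "qf m \<le> qf p / 2 + qf r / 2" by simp
  moreover have "4 * qf m = qf p + bracket p r + qf r"
    unfolding m_def by (cases p; cases r) (simp add: blinfun.bilinear_simps add_divide_distrib)
  ultimately show ?thesis by (simp add: qf_diff)
qed

text \<open>A quantitative form of the constraint qualification: small vectors of \<open>L\<close>
  are differences of first components with one bound on values and norms alike. This uniformity is
  what a Lagrange multiplier requires.\<close>

lemma lsc_convex_ball_subset_diff:
  fixes f g :: "'a::banach \<times> ('a \<Rightarrow>\<^sub>L real) \<Rightarrow> ereal"
  assumes f: "proper_fun f" "convex_fun f" "lsc_fun f" and g: "proper_fun g" "convex_fun g" "lsc_fun g"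
    and L: "subspace L" "closed L"
    and L_eq: "L = (\<Union>r\<in>{0::real<..}. (\<lambda>v. r *\<^sub>R v) ` {a - b | a b. a \<in> pi1 ` edom f \<and> b \<in> pi1 ` edom g})"
  obtains n :: nat and \<delta> where "0 < \<delta>"
    "\<And>v. v \<in> L \<Longrightarrow> norm v < \<delta> \<Longrightarrow> \<exists>p r. fst p - fst r = v \<and> f p \<le> ereal n \<and> g r \<le> ereal n \<and> norm p \<le> n \<and> norm r \<le> n"
proof -
  define A :: "('a \<times> ('a \<Rightarrow>\<^sub>L real)) \<times> ('a \<times> ('a \<Rightarrow>\<^sub>L real)) \<Rightarrow> 'a"
    where "A = (\<lambda>z. fst (fst z) - fst (snd z))"
  \<comment> \<open>Lower semicontinuity makes these truncated sublevel sets closed, and they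
    exhaust \<open>edom f \<times> edom g\<close>.\<close>
  define C where "C n = ({p. f p \<le> ereal (real n)} \<times> {r. g r \<le> ereal (real n)}) \<inter> cball 0 (real n)" for n :: nat
  have "bounded_linear A"
    unfolding A_def by (intro bounded_linear_intros)
  moreover note L
  moreover have "closed (C n)" "convex (C n)" "bounded (C n)" for n
    unfolding C_def
    using f g by (auto intro!: closed_Int closed_Times convex_Int convex_Times convex_sublevel simp: lsc_fun_def)
  moreover have "incseq C"
    unfolding incseq_def C_def
  proof (intro allI impI Int_mono Sigma_mono subsetI)
    fix m n :: nat and p assume "m \<le> n"
    then have *: "ereal (real m) \<le> ereal (real n)" by simp
    show "p \<in> {p. f p \<le> ereal (real m)} \<Longrightarrow> p \<in> {p. f p \<le> ereal (real n)}"
      using * by (auto intro: order_trans)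
    show "r \<in> {p. g p \<le> ereal (real m)} \<Longrightarrow> r \<in> {p. g p \<le> ereal (real n)}" for r
      using * by (auto intro: order_trans)
    show "z \<in> cball 0 (real m) \<Longrightarrow> z \<in> cball 0 (real n)" for z :: "('a \<times> ('a \<Rightarrow>\<^sub>L real)) \<times> ('a \<times> ('a \<Rightarrow>\<^sub>L real))"
      using \<open>m \<le> n\<close> by simp
  qed
  moreover have "L = (\<Union>r\<in>{0<..}. (*\<^sub>R) r ` A ` (\<Union>n. C n))"
  proof -
    have "(\<Union>n. C n) = edom f \<times> edom g"
    proof (intro subset_antisym subsetI)
      fix z assume "z \<in> (\<Union>n. C n)"
      then obtain n where "f (fst z) \<le> ereal (real n)" "g (snd z) \<le> ereal (real n)"
        by (auto simp: C_def)
      then show "z \<in> edom f \<times> edom g"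
        using edom_iff(1)[OF f(1)] edom_iff(1)[OF g(1)] by (auto simp: mem_Times_iff)
    next
      fix z assume z: "z \<in> edom f \<times> edom g"
      obtain n :: nat where n: "max (max (real_of_ereal (f (fst z))) (real_of_ereal (g (snd z)))) (norm z) \<le> real n"
        using real_arch_simple by blast
      have "f (fst z) \<le> ereal (real n)" "g (snd z) \<le> ereal (real n)"
        using n z edom_iff(2)[OF f(1), of "fst z"] edom_iff(2)[OF g(1), of "snd z"]
        by (auto simp: mem_Times_iff) (metis ereal_less_eq(3))+
      then show "z \<in> (\<Union>n. C n)"
        using n by (auto simp: C_def mem_Times_iff)
    qed
    moreover have "{a - b | a b. a \<in> pi1 ` edom f \<and> b \<in> pi1 ` edom g} = A ` (edom f \<times> edom g)"
      unfolding A_def pi1_def by force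
    ultimately show ?thesis unfolding L_eq by simp
  qed
  ultimately obtain n \<delta> where \<delta>: "0 < \<delta>" and ball: "\<And>v. v \<in> L \<Longrightarrow> norm v < \<delta> \<Longrightarrow> v \<in> A ` C n"
    by (rule ball_subset_image_of_exhaustion) blast
  show thesis
  proof (rule that[OF \<delta>])
    fix v assume "v \<in> L" "norm v < \<delta>"
    then obtain p r where "(p, r) \<in> C n" "v = A (p, r)"
      using ball[of v] by (metis imageE surj_pair)
    then have *: "fst p - fst r = v" "f p \<le> ereal n" "g r \<le> ereal n" "norm (p, r) \<le> n"
      by (simp_all add: C_def A_def)
    show "\<exists>p r. fst p - fst r = v \<and> f p \<le> ereal n \<and> g r \<le> ereal n \<and> norm p \<le> n \<and> norm r \<le> n"
      using * order_trans[OF norm_fst_le *(4)] order_trans[OF norm_snd_le *(4)] by blast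
  qed
qed

text \<open>One multiplier handles the constraint \<open>x = x'\<close> and the comparison of \<open>(x, s + t)\<close> with \<open>P\<close> at the
  same time, so that the partial inf-convolution of \<open>f\<close> and \<open>g\<close> is never formed.\<close>

lemma sum_multiplier:
  fixes f g :: "'a::banach \<times> ('a \<Rightarrow>\<^sub>L real) \<Rightarrow> ereal"
  assumes f: "lsc_fun f" "BC_function f" and g: "lsc_fun g" "BC_function g"
    and L: "subspace L" "closed L"
    and L_eq: "L = (\<Union>r\<in>{0::real<..}. (\<lambda>v. r *\<^sub>R v) ` {a - b | a b. a \<in> pi1 ` edom f \<and> b \<in> pi1 ` edom g})"
    and G: "convex_on UNIV G" "\<And>P. 0 \<le> qf P + G P" "\<And>R. \<exists>N. \<forall>P. norm P \<le> R \<longrightarrow> G P \<le> N"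
  obtains \<xi> \<eta> :: "'a \<Rightarrow>\<^sub>L real" and \<Phi> :: "('a \<Rightarrow>\<^sub>L real) \<Rightarrow>\<^sub>L real" where
    "\<And>p r P. p \<in> edom f \<Longrightarrow> r \<in> edom g \<Longrightarrow>
      0 \<le> real_of_ereal (f p) + real_of_ereal (g r) + G P + blinfun_apply \<xi> (fst p - fst r)
        + blinfun_apply \<eta> (fst p - fst P) + blinfun_apply \<Phi> (snd p + snd r - snd P)"
proof -
  have pf: "proper_fun f" "convex_fun f" and pg: "proper_fun g" "convex_fun g"
    using f g by (auto simp: BC_function_def)
  define F where "F = (\<lambda>((p, r), P). real_of_ereal (f p) + real_of_ereal (g r) + G P)"
  \<comment> \<open>The last two components take any value by choice of \<open>P\<close>, so the
    constraint qualification concerns the first one only.\<close>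
  define j where "j = (\<lambda>((p, r), P). (fst p - fst r, fst p - fst P, snd p + snd r - snd P)
    :: 'a \<times> 'a \<times> ('a \<Rightarrow>\<^sub>L real))"
  define D where "D = (edom f \<times> edom g) \<times> (UNIV :: ('a \<times> ('a \<Rightarrow>\<^sub>L real)) set)"
  obtain n \<delta> where \<delta>: "0 < \<delta>" and ball: "\<And>v. v \<in> L \<Longrightarrow> norm v < \<delta> \<Longrightarrow>
      \<exists>p r. fst p - fst r = v \<and> f p \<le> ereal (real n) \<and> g r \<le> ereal (real n) \<and> norm p \<le> n \<and> norm r \<le> n"
    using lsc_convex_ball_subset_diff[OF pf f(1) pg g(1) L L_eq] by blast
  have j: "linear j"
    by (rule linearI) (auto simp: j_def algebra_simps)
  have convD: "convex D"
    unfolding D_def using convex_fun_imp_convex_on[OF pf] convex_fun_imp_convex_on[OF pg]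
    by (intro convex_Times convex_UNIV) (auto dest: convex_on_imp_convex)
  have F: "convex_on D F"
  proof -
    have "convex_on D (\<lambda>z. real_of_ereal (f (fst (fst z))))"
    proof (rule convex_on_subset[OF convex_on_linear_vimage[OF convex_fun_imp_convex_on[OF pf]] _ convD])
      show "linear (\<lambda>z::(('a \<times> ('a \<Rightarrow>\<^sub>L real)) \<times> ('a \<times> ('a \<Rightarrow>\<^sub>L real))) \<times> ('a \<times> ('a \<Rightarrow>\<^sub>L real)). fst (fst z))"
        by (rule linearI) auto
    qed (auto simp: D_def)
    moreover have "convex_on D (\<lambda>z. real_of_ereal (g (snd (fst z))))"
    proof (rule convex_on_subset[OF convex_on_linear_vimage[OF convex_fun_imp_convex_on[OF pg]] _ convD])
      show "linear (\<lambda>z::(('a \<times> ('a \<Rightarrow>\<^sub>L real)) \<times> ('a \<times> ('a \<Rightarrow>\<^sub>L real))) \<times> ('a \<times> ('a \<Rightarrow>\<^sub>L real)). snd (fst z))"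
        by (rule linearI) auto
    qed (auto simp: D_def)
    moreover have "convex_on D (\<lambda>z. G (snd z))"
    proof (rule convex_on_subset[OF convex_on_linear_vimage[OF G(1)] _ convD])
      show "linear (\<lambda>z::(('a \<times> ('a \<Rightarrow>\<^sub>L real)) \<times> ('a \<times> ('a \<Rightarrow>\<^sub>L real))) \<times> ('a \<times> ('a \<Rightarrow>\<^sub>L real)). snd z)"
        by (rule linearI) auto
    qed auto
    ultimately show ?thesis
      unfolding F_def case_prod_beta by (intro convex_on_add)
  qed
  have LL: "subspace (L \<times> (UNIV :: ('a \<times> ('a \<Rightarrow>\<^sub>L real)) set))"
    using L(1) by (intro subspace_Times subspace_UNIV)
  have jD: "j ` D \<subseteq> L \<times> UNIV"
  proof -
    have "a - b \<in> L" if "a \<in> pi1 ` edom f" "b \<in> pi1 ` edom g" for a b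
    proof -
      have "1 *\<^sub>R (a - b) \<in> L"
        unfolding L_eq using that by (intro UN_I[of 1] imageI) auto
      then show ?thesis by simp
    qed
    then show ?thesis by (auto simp: j_def D_def pi1_def)
  qed
  \<comment> \<open>The radius allows for \<open>fst p\<close>, \<open>snd p\<close> and
    \<open>snd r\<close>, each of norm at most \<open>n\<close>, and two perturbations of norm below
    1.\<close>
  obtain N where N: "\<And>P. norm P \<le> 3 * real n + 2 \<Longrightarrow> G P \<le> N"
    using G(3) by blast
  have balls: "\<exists>z\<in>D. j z = v \<and> F z \<le> real n + real n + N" if v: "v \<in> L \<times> UNIV" "norm v < min \<delta> 1" for v
  proof -
    obtain v0 a b where v_eq: "v = (v0, a, b)" by (metis surj_pair)
    have ab: "norm v0 \<le> norm v" "norm a \<le> norm v" "norm b \<le> norm v"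
      unfolding v_eq using norm_fst_le[of v0 "(a, b)"] norm_snd_le[of "(a, b)" v0]
        norm_fst_le[of a b] norm_snd_le[of b a] by linarith+
    obtain p r where pr: "fst p - fst r = v0" "f p \<le> ereal (real n)" "g r \<le> ereal (real n)"
      "norm p \<le> n" "norm r \<le> n"
      using ball[of v0] v ab v_eq by auto
    define P where "P = (fst p - a, snd p + snd r - b)"
    have dom: "p \<in> edom f" "r \<in> edom g"
      using pr edom_iff(1)[OF pf(1)] edom_iff(1)[OF pg(1)] by auto
    have "norm (fst p) \<le> n" "norm (snd p) \<le> n" "norm (snd r) \<le> n"
      using pr(4,5) norm_fst_le[of "fst p" "snd p"] norm_snd_le[of "snd p" "fst p"] norm_snd_le[of "snd r" "fst r"]
      by simp_all
    then have "norm P \<le> 3 * real n + 2"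
      using norm_Pair_le[of "fst p - a" "snd p + snd r - b"] norm_triangle_ineq4[of "fst p" a]
        norm_triangle_ineq4[of "snd p + snd r" b] norm_triangle_ineq[of "snd p" "snd r"] ab v(2)
      by (simp add: P_def)
    then have "G P \<le> N" by (rule N)
    moreover have "real_of_ereal (f p) \<le> n" "real_of_ereal (g r) \<le> n"
      using pr(2,3) edom_iff(2)[OF pf(1) dom(1)] edom_iff(2)[OF pg(1) dom(2)] by (metis ereal_less_eq(3))+
    ultimately have "F ((p, r), P) \<le> real n + real n + N" by (simp add: F_def)
    moreover have "((p, r), P) \<in> D" using dom by (simp add: D_def)
    moreover have "j ((p, r), P) = v" using pr(1) by (simp add: j_def P_def v_eq)
    ultimately show ?thesis by blast
  qed
  have nonneg: "0 \<le> F z" if z: "z \<in> D" "j z = 0" for z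
  proof -
    obtain x s y t P where z_eq: "z = (((x, s), (y, t)), P)" by (metis surj_pair)
    \<comment> \<open>On the constraint set the two pairs share their first component, so
      \<open>qf (x, s) + qf (x, t) = qf P\<close>, and \<open>qf P + G P \<ge> 0\<close>
      applies.\<close>
    have y: "y = x" and P: "P = (x, s + t)"
      using z(2) by (cases P; simp add: j_def z_eq zero_prod_def)+
    have "qf p \<le> real_of_ereal (k p)" if "BC_function k" "p \<in> edom k" for k and p :: "'a \<times> ('a \<Rightarrow>\<^sub>L real)"
    proof -
      have "ereal (qf p) \<le> k p" "proper_fun k"
        using that(1) unfolding BC_function_def by blast+
      then show ?thesis
        using edom_iff(2)[of k p] that(2) by (metis ereal_less_eq(3))
    qed
    from this[OF f(2), of "(x, s)"] this[OF g(2), of "(y, t)"]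
    show ?thesis
      using G(2)[of P] z(1) by (simp add: z_eq F_def D_def y P blinfun.add_left)
  qed
  have "0 < min \<delta> 1" using \<delta> by simp
  from this balls nonneg have "\<exists>\<zeta>. \<forall>z\<in>D. 0 \<le> F z + blinfun_apply \<zeta> (j z)"
  proof (rule Lagrange_multiplier[OF j F LL jD])
    fix \<zeta> assume *: "\<And>z. z \<in> D \<Longrightarrow> 0 \<le> F z + blinfun_apply \<zeta> (j z)"
    show ?thesis by (intro exI ballI, rule *)
  qed
  then obtain \<zeta> where \<zeta>: "\<And>z. z \<in> D \<Longrightarrow> 0 \<le> F z + blinfun_apply \<zeta> (j z)"
    by meson
  define \<xi> where "\<xi> = Blinfun (\<lambda>u. blinfun_apply \<zeta> (u, 0, 0))"
  define \<eta> where "\<eta> = Blinfun (\<lambda>u. blinfun_apply \<zeta> (0, u, 0))"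
  define \<Phi> where "\<Phi> = Blinfun (\<lambda>u. blinfun_apply \<zeta> (0, 0, u))"
  have split: "blinfun_apply \<zeta> (u, v, w) = blinfun_apply \<xi> u + blinfun_apply \<eta> v + blinfun_apply \<Phi> w" for u v w
  proof -
    have "blinfun_apply \<xi> u = blinfun_apply \<zeta> (u, 0, 0)"
      unfolding \<xi>_def by (subst bounded_linear_Blinfun_apply) (intro bounded_linear_intros, rule refl)
    moreover have "blinfun_apply \<eta> v = blinfun_apply \<zeta> (0, v, 0)"
      unfolding \<eta>_def by (subst bounded_linear_Blinfun_apply) (intro bounded_linear_intros, rule refl)
    moreover have "blinfun_apply \<Phi> w = blinfun_apply \<zeta> (0, 0, w)"
      unfolding \<Phi>_def by (subst bounded_linear_Blinfun_apply) (intro bounded_linear_intros, rule refl)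
    ultimately show ?thesis by (simp flip: blinfun.add_right)
  qed
  show thesis
  proof (rule that[of \<xi> \<eta> \<Phi>])
    fix p r P assume "p \<in> edom f" "r \<in> edom g"
    then show "0 \<le> real_of_ereal (f p) + real_of_ereal (g r) + G P + blinfun_apply \<xi> (fst p - fst r)
        + blinfun_apply \<eta> (fst p - fst P) + blinfun_apply \<Phi> (snd p + snd r - snd P)"
      using \<zeta>[of "((p, r), P)"] by (simp add: F_def D_def j_def split add.assoc)
  qed
qed

lemma exists_near_sum:
  fixes f g :: "'a::banach \<times> ('a \<Rightarrow>\<^sub>L real) \<Rightarrow> ereal"
  assumes refl: "reflexive_space TYPE('a)"
    and f: "lsc_fun f" "BC_function f" and g: "lsc_fun g" "BC_function g"
    and L: "subspace L" "closed L"
    and L_eq: "L = (\<Union>r\<in>{0::real<..}. (\<lambda>v. r *\<^sub>R v) ` {a - b | a b. a \<in> pi1 ` edom f \<and> b \<in> pi1 ` edom g})"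
  obtains y s t where "(y, s) \<in> Pq f" "(y, t) \<in> Pq g"
    "qf ((y, s + t) - w) + ((norm (y - fst w))\<^sup>2 + (norm (s + t - snd w))\<^sup>2) / 2 \<le> 0"
proof -
  \<comment> \<open>This is \<open>qf (P - w) - qf P\<close> plus the half squares, written so that
    convexity in \<open>P\<close> is visible: the quadratic part of \<open>qf\<close> has
    cancelled.\<close>
  define G where "G P = (1/2) * (norm (fst P - fst w))\<^sup>2 + (1/2) * (norm (snd P - snd w))\<^sup>2
    + (qf w - bracket P w)" for P :: "'a \<times> ('a \<Rightarrow>\<^sub>L real)"
  have "convex_on UNIV G"
  proof -
    have "convex_on UNIV (\<lambda>P::'a \<times> ('a \<Rightarrow>\<^sub>L real). (norm (fst P - fst w))\<^sup>2)"
      "convex_on UNIV (\<lambda>P::'a \<times> ('a \<Rightarrow>\<^sub>L real). (norm (snd P - snd w))\<^sup>2)"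
      using convex_on_linear_vimage[OF convex_on_norm_diff_square linear_fst]
        convex_on_linear_vimage[OF convex_on_norm_diff_square linear_snd] by auto
    moreover have "convex_on UNIV (\<lambda>P. qf w - bracket P w)"
      by (rule convex_onI) (auto simp: bracket_def blinfun.bilinear_simps algebra_simps)
    ultimately show ?thesis unfolding G_def by (intro convex_on_add convex_on_cmul) auto
  qed
  moreover have "0 \<le> qf P + G P" for P
    using qf_add_half_norm_square_nonneg[of "P - w"] by (simp add: G_def qf_diff field_simps)
  moreover have "\<exists>N. \<forall>P. norm P \<le> R \<longrightarrow> G P \<le> N" for R
  proof (intro exI allI impI)
    fix P :: "'a \<times> ('a \<Rightarrow>\<^sub>L real)" assume "norm P \<le> R"
    then have P: "norm (fst P) \<le> R" "norm (snd P) \<le> R"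
      using norm_fst_le[of "fst P" "snd P"] norm_snd_le[of "snd P" "fst P"] by simp_all
    have "norm (fst P - fst w) \<le> R + norm (fst w)" "norm (snd P - snd w) \<le> R + norm (snd w)"
      using P norm_triangle_ineq4[of "fst P" "fst w"] norm_triangle_ineq4[of "snd P" "snd w"] by linarith+
    moreover have "- bracket P w \<le> norm (snd w) * R + R * norm (fst w)"
    proof -
      have "- bracket P w \<le> norm (snd w) * norm (fst P) + norm (snd P) * norm (fst w)"
        using bracket_le[of P w] by linarith
      also have "\<dots> \<le> norm (snd w) * R + R * norm (fst w)"
        using P by (intro add_mono mult_mono) (auto intro: order_trans[OF norm_ge_zero])
      finally show ?thesis .
    qed
    ultimately show "G P \<le> (1/2) * (R + norm (fst w))\<^sup>2 + (1/2) * (R + norm (snd w))\<^sup>2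
        + (qf w + (norm (snd w) * R + R * norm (fst w)))"
      unfolding G_def by (intro add_mono mult_left_mono power_mono) auto
  qed
  ultimately obtain \<xi> \<eta> \<Phi> where mult: "\<And>p r P. p \<in> edom f \<Longrightarrow> r \<in> edom g \<Longrightarrow>
      0 \<le> real_of_ereal (f p) + real_of_ereal (g r) + G P + blinfun_apply \<xi> (fst p - fst r)
        + blinfun_apply \<eta> (fst p - fst P) + blinfun_apply \<Phi> (snd p + snd r - snd P)"
    by (rule sum_multiplier[OF f g L L_eq]) blast
  obtain y where y: "\<And>\<phi>. blinfun_apply \<Phi> \<phi> = blinfun_apply \<phi> y"
    using refl unfolding reflexive_space_def by blast
  \<comment> \<open>Collecting the terms in \<open>p\<close>, \<open>r\<close> and \<open>P\<close>
    turns the multiplier inequality into \<open>0 \<le> f p - bracket p a + g r - bracket r b + G P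
    + bracket P m\<close>.\<close>
  define m where "m = (- y, - \<eta>)"
  define a where "a = (- y, - \<xi> - \<eta>)"
  define b where "b = (- y, \<xi>)"
  define d where "d = m - w"
  define h where "h = ((norm (fst d))\<^sup>2 + (norm (snd d))\<^sup>2) / 2"
  \<comment> \<open>\<open>P = w + (u, \<psi>)\<close> is chosen to minimise
    \<open>G P + bracket P m\<close>. Each component of the displacement pairs with \<open>d\<close>
    to minus a squared norm; for \<open>u\<close> this uses that \<open>snd d\<close> attains its
    norm.\<close>
  obtain P where P: "G P + bracket P m \<le> bracket w m - qf w - h"
  proof -
    obtain x where x: "norm x \<le> 1" "blinfun_apply (snd d) x = norm (snd d)"
      using reflexive_norm_attained[OF refl] .
    obtain \<phi> :: "'a \<Rightarrow>\<^sub>L real" where \<phi>: "norm \<phi> \<le> 1" "blinfun_apply \<phi> (fst d) = norm (fst d)"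
      by (rule norming_functional)
    define u where "u = - (norm (snd d) *\<^sub>R x)"
    define \<psi> where "\<psi> = - (norm (fst d) *\<^sub>R \<phi>)"
    have "norm u \<le> norm (snd d)" "norm \<psi> \<le> norm (fst d)"
      using x(1) \<phi>(1) by (simp_all add: u_def \<psi>_def mult_left_le)
    then have sq: "(norm u)\<^sup>2 \<le> (norm (snd d))\<^sup>2" "(norm \<psi>)\<^sup>2 \<le> (norm (fst d))\<^sup>2"
      by (auto intro: power_mono)
    have "bracket (u, \<psi>) d = - (norm (snd d))\<^sup>2 - (norm (fst d))\<^sup>2"
      by (simp add: bracket_def u_def \<psi>_def blinfun.bilinear_simps x(2) \<phi>(2) power2_eq_square)
    moreover have "G (w + (u, \<psi>)) + bracket (w + (u, \<psi>)) m
        = bracket w m - qf w + bracket (u, \<psi>) d + ((norm u)\<^sup>2 + (norm \<psi>)\<^sup>2) / 2"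
      by (simp add: G_def d_def bracket_def qf_def blinfun.bilinear_simps field_simps)
    ultimately have eq: "G (w + (u, \<psi>)) + bracket (w + (u, \<psi>)) m
        = bracket w m - qf w - (norm (snd d))\<^sup>2 - (norm (fst d))\<^sup>2 + ((norm u)\<^sup>2 + (norm \<psi>)\<^sup>2) / 2"
      by simp
    have half: "c - \<beta> - \<alpha> + (\<alpha>' + \<beta>') / 2 \<le> c - (\<beta> + \<alpha>) / 2" if "\<alpha>' \<le> \<alpha>" "\<beta>' \<le> \<beta>"
      for c \<alpha> \<alpha>' \<beta> \<beta>' :: real
      using that by (simp add: field_simps)
    have "G (w + (u, \<psi>)) + bracket (w + (u, \<psi>)) m \<le> bracket w m - qf w - h"
      unfolding eq h_def using half[OF sq(2,1)] by (simp add: algebra_simps)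
    then show thesis by (rule that)
  qed
  have sum: "(bracket p a - real_of_ereal (f p)) + (bracket r b - real_of_ereal (g r)) \<le> bracket w m - qf w - h"
    if "p \<in> edom f" "r \<in> edom g" for p r
    using mult[OF that, of P] P
    by (simp add: a_def b_def m_def bracket_def y blinfun.bilinear_simps)
  have "qf a + qf b = qf m"
    by (simp add: a_def b_def m_def blinfun.bilinear_simps)
  moreover have "qf d = qf m - bracket w m + qf w"
    by (simp add: d_def qf_diff bracket_def add.commute)
  moreover have "0 \<le> qf d + h"
    using qf_add_half_norm_square_nonneg[of d] by (simp add: h_def)
  \<comment> \<open>With \<open>c = bracket w m - qf w - h\<close> one has
    \<open>qf a + qf b - c = qf d + h\<close>. Its nonnegativity gives the memberships, and
    \<open>qf a + qf b \<le> c\<close> gives the final estimate.\<close>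
  ultimately have "a \<in> Pq f \<and> b \<in> Pq g" "qf d + h \<le> 0"
    using mem_Pq_of_conj_sum_le[OF f(2) g(2) sum] by linarith+
  then show thesis
    by (intro that[of "- y" "- \<xi> - \<eta>" \<xi>]) (simp_all add: a_def b_def d_def m_def h_def)
qed

section \<open>Maximal monotonicity of the pointwise sum\<close>

lemma monotone_set_iff_qf: "monotone_set A \<longleftrightarrow> A \<noteq> {} \<and> (\<forall>p\<in>A. \<forall>r\<in>A. 0 \<le> qf (p - r))"
  by (simp add: monotone_set_def qf_def case_prod_beta)

theorem theorem5p4:
  fixes f g :: "'a::banach \<times> ('a \<Rightarrow>\<^sub>L real) \<Rightarrow> ereal"
  assumes "reflexive_space TYPE('a)"
    and "\<exists>x::'a. x \<noteq> 0"
    and "proper_fun f" and "convex_fun f" and "lsc_fun f" and "BC_function f"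
    and "proper_fun g" and "convex_fun g" and "lsc_fun g" and "BC_function g"
    and "subspace (\<Union>r\<in>{0::real<..}. (\<lambda>v. r *\<^sub>R v) `
                     {a - b | a b. a \<in> pi1 ` edom f \<and> b \<in> pi1 ` edom g})"
    and "closed (\<Union>r\<in>{0::real<..}. (\<lambda>v. r *\<^sub>R v) `
                     {a - b | a b. a \<in> pi1 ` edom f \<and> b \<in> pi1 ` edom g})"
  shows "maximally_monotone
           {(x, s + t) | x s t. (x, s) \<in> Pq f \<and> (x, t) \<in> Pq g}"
proof -
  define M where "M = {(x, s + t) | x s t. (x, s) \<in> Pq f \<and> (x, t) \<in> Pq g}"
  have near: "\<exists>m\<in>M. qf (m - w) + ((norm (fst (m - w)))\<^sup>2 + (norm (snd (m - w)))\<^sup>2) / 2 \<le> 0" for w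
  proof -
    obtain y s t where "(y, s) \<in> Pq f" "(y, t) \<in> Pq g"
      "qf ((y, s + t) - w) + ((norm (y - fst w))\<^sup>2 + (norm (s + t - snd w))\<^sup>2) / 2 \<le> 0"
      by (rule exists_near_sum[OF assms(1,5,6,9,10,11,12) refl])
    then show ?thesis
      by (intro bexI[of _ "(y, s + t)"]) (auto simp: M_def)
  qed
  have "0 \<le> qf (p - r)" if "p \<in> M" "r \<in> M" for p r
  proof -
    obtain x s t where p: "p = (x, s + t)" "(x, s) \<in> Pq f" "(x, t) \<in> Pq g"
      using \<open>p \<in> M\<close> by (auto simp: M_def)
    obtain y s' t' where r: "r = (y, s' + t')" "(y, s') \<in> Pq f" "(y, t') \<in> Pq g"
      using \<open>r \<in> M\<close> by (auto simp: M_def)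
    \<comment> \<open>Both summands share the first component \<open>x - y\<close>, on which the
      dual components act additively.\<close>
    have "qf (p - r) = qf ((x, s) - (y, s')) + qf ((x, t) - (y, t'))"
      by (simp add: p r blinfun.bilinear_simps)
    then show ?thesis
      using Pq_monotone[OF assms(6) p(2) r(2)] Pq_monotone[OF assms(10) p(3) r(3)] by simp
  qed
  moreover have "M \<noteq> {}" using near by blast
  ultimately have "monotone_set M" by (simp add: monotone_set_iff_qf)
  moreover have "B = M" if B: "monotone_set B" "M \<subseteq> B" for B
  proof
    show "B \<subseteq> M"
    proof
      fix w assume "w \<in> B"
      obtain m where m: "m \<in> M" "qf (m - w) + ((norm (fst (m - w)))\<^sup>2 + (norm (snd (m - w)))\<^sup>2) / 2 \<le> 0"
        using near by blast
      have "0 \<le> qf (m - w)"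
        using B m(1) \<open>w \<in> B\<close> by (auto simp: monotone_set_iff_qf)
      have half: "c \<le> 0" if "d + c / 2 \<le> 0" "0 \<le> d" for c d :: real
        using that by linarith
      have "(norm (fst (m - w)))\<^sup>2 + (norm (snd (m - w)))\<^sup>2 \<le> 0"
        using m(2) \<open>0 \<le> qf (m - w)\<close> by (rule half)
      then have "m = w"
        by (simp add: sum_power2_le_zero_iff prod_eq_iff)
      with m(1) show "w \<in> M" by simp
    qed
  qed (rule B(2))
  ultimately show ?thesis unfolding maximally_monotone_def M_def by blast
qed

end
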